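(* Every $1$-unique graph with tree-depth $k$ has a $k$-critical spanning subgraph.
   Context: Graphs are finite and simple. A $k$-ranking of a graph $G$ is a labeling of $V(G)$ with values from $\{1,\dots,k\}$ such that every path joining two distinct vertices with the same label contains a vertex having a larger label. The tree-depth $\mathrm{td}(G)$ is the smallest $k$ for which $G$ has a $k$-ranking (the graph with no vertices has tree-depth $0$). A ranking of $G$ is optimal if it is a $\mathrm{td}(G)$-ranking. A graph is $k$-critical if it has tree-depth $k$ and every proper minor of it has tree-depth less than $k$. A graph $G$ is $1$-unique if for every vertex $v$ of $G$ there is an optimal ranking of $G$ in which $v$ is the only vertex receiving label $1$. A spanning subgraph of $G$ is a subgraph with the same vertex set as $G$. *)

theory Defs
  imports "Graph_Theory.Graph_Theory"
begin

text \<open>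
  A finite simple graph is a \<^locale>\<open>pair_graph\<close>: finite, loop-free and symmetric, so that an edge
  between \<open>u\<close> and \<open>v\<close> is the pair of arcs \<open>(u, v)\<close> and \<open>(v, u)\<close>. The definitions below are meant
  for such graphs.
\<close>

subsection \<open>Rankings and tree-depth\<close>

text \<open>A labeling is a total function of which only the values on \<open>pverts G\<close> matter.\<close>

definition is_ranking :: "nat \<Rightarrow> 'a pair_pre_digraph \<Rightarrow> ('a \<Rightarrow> nat) \<Rightarrow> bool" where
  "is_ranking k G f \<longleftrightarrow>
     f ` pverts G \<subseteq> {1..k} \<and>
     (\<forall>p. vpath p G \<and> hd p \<noteq> last p \<and> f (hd p) = f (last p) \<longrightarrow> (\<exists>w \<in> set p. f w > f (hd p)))"

text \<open>A finite graph with \<open>n\<close> vertices has an \<open>n\<close>-ranking, so the minimum below is attained.\<close>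

definition tree_depth :: "'a pair_pre_digraph \<Rightarrow> nat" where
  "tree_depth G = (LEAST k. \<exists>f. is_ranking k G f)"

definition optimal_ranking :: "'a pair_pre_digraph \<Rightarrow> ('a \<Rightarrow> nat) \<Rightarrow> bool" where
  "optimal_ranking G f \<longleftrightarrow> is_ranking (tree_depth G) G f"

definition one_unique :: "'a pair_pre_digraph \<Rightarrow> bool" where
  "one_unique G \<longleftrightarrow>
     (\<forall>v \<in> pverts G. \<exists>f. optimal_ranking G f \<and> {u \<in> pverts G. f u = 1} = {v})"

subsection \<open>Minors and criticality\<close>

definition delete_vertex :: "'a \<Rightarrow> 'a pair_pre_digraph \<Rightarrow> 'a pair_pre_digraph" where
  "delete_vertex v G =
     \<lparr>pverts = pverts G - {v}, parcs = {(x, y) \<in> parcs G. x \<noteq> v \<and> y \<noteq> v}\<rparr>"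

definition delete_edge :: "'a \<Rightarrow> 'a \<Rightarrow> 'a pair_pre_digraph \<Rightarrow> 'a pair_pre_digraph" where
  "delete_edge u v G = \<lparr>pverts = pverts G, parcs = parcs G - {(u, v), (v, u)}\<rparr>"

text \<open>
  Contracting \<open>uv\<close> identifies \<open>v\<close> with \<open>u\<close>; the merged vertex keeps the name \<open>u\<close>. Loops are
  discarded, and parallel edges merge because the arcs form a set.
\<close>

definition contract_edge :: "'a \<Rightarrow> 'a \<Rightarrow> 'a pair_pre_digraph \<Rightarrow> 'a pair_pre_digraph" where
  "contract_edge u v G =
     (let m = (\<lambda>x. if x = v then u else x)
      in \<lparr>pverts = pverts G - {v}, parcs = {(m x, m y) | x y. (x, y) \<in> parcs G \<and> m x \<noteq> m y}\<rparr>)"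

inductive minor_step :: "'a pair_pre_digraph \<Rightarrow> 'a pair_pre_digraph \<Rightarrow> bool" for G where
  "v \<in> pverts G \<Longrightarrow> minor_step G (delete_vertex v G)"
| "(u, v) \<in> parcs G \<Longrightarrow> minor_step G (delete_edge u v G)"
| "(u, v) \<in> parcs G \<Longrightarrow> minor_step G (contract_edge u v G)"

text \<open>
  Each step on a finite simple graph lowers the number of vertices or of edges, so the proper minors
  are the graphs reached in at least one step. Since a contraction reuses the name of an end of the
  edge, every proper minor has an isomorphic copy with vertices among those of \<open>G\<close>.
\<close>

definition proper_minor :: "'a pair_pre_digraph \<Rightarrow> 'a pair_pre_digraph \<Rightarrow> bool" where
  "proper_minor H G \<longleftrightarrow> minor_step\<^sup>+\<^sup>+ G H"

definition critical :: "nat \<Rightarrow> 'a pair_pre_digraph \<Rightarrow> bool" where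
  "critical k G \<longleftrightarrow> tree_depth G = k \<and> (\<forall>H. proper_minor H G \<longrightarrow> tree_depth H < k)"

end

theory Submission
  imports Defs
begin

text \<open>
  Among the spanning subgraphs of \<open>G\<close> that still have tree-depth \<open>k\<close>, let \<open>H\<close> be one with as few
  arcs as possible. Deleting any edge of \<open>H\<close> then lowers the tree-depth. Moreover \<open>H\<close> inherits
  1-uniqueness: a \<open>k\<close>-ranking of \<open>G\<close> is also a \<open>k\<close>-ranking of \<open>H\<close>, and it is optimal for \<open>H\<close>
  because the tree-depth has not dropped.

  In a 1-unique graph, deleting a vertex \<open>v\<close> or contracting an edge \<open>uv\<close> lowers the tree-depth. Take
  an optimal ranking in which \<open>v\<close> alone has label 1, and let the merged vertex keep the label of \<open>u\<close>.
  After either operation the labeling is still a ranking, because passing through \<open>v\<close> never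
  increases the largest label on a path; but now label 1 is free, and subtracting 1 everywhere
  saves a label (\<open>tree_depth_less\<close>). So every minor step from \<open>H\<close> lowers the tree-depth, and as tree-depth
  is minor-monotone (\<open>tree_depth_minor_step_le\<close>), later steps cannot raise it again.

  That rankings survive the three operations comes from one observation. Whether a labeling is a
  ranking depends, apart from the range of its labels, only on which vertices are joined through labels at most \<open>c\<close>, for each \<open>c\<close>
  (\<open>is_ranking_iff_low_arcs\<close>), so rankings can be pulled back along any injection of vertices that
  respects these connections (\<open>is_ranking_pullback\<close>).
\<close>

section \<open>Rankings and connectivity through small labels\<close>

definition low_arcs :: "'a pair_pre_digraph \<Rightarrow> ('a \<Rightarrow> nat) \<Rightarrow> nat \<Rightarrow> 'a rel" where
  "low_arcs G f c = {(a, b) \<in> parcs G. f a \<le> c \<and> f b \<le> c}"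

lemma low_arcs_mono: "c \<le> d \<Longrightarrow> (low_arcs G f c)\<^sup>* \<subseteq> (low_arcs G f d)\<^sup>*"
  by (rule rtrancl_mono) (auto simp: low_arcs_def)

lemma vwalk_imp_low_arcs:
  assumes "vwalk p (with_proj G)" and "\<forall>w \<in> set p. f w \<le> c"
  shows "(hd p, last p) \<in> (low_arcs G f c)\<^sup>*"
  using assms
proof (induction p rule: vwalk_arcs.induct)
  case (3 x y xs)
  then have "vwalk (y # xs) (with_proj G)" and "(x, y) \<in> low_arcs G f c"
    by (auto simp: vwalk_def low_arcs_def)
  with 3 show ?case
    by (auto intro: converse_rtrancl_into_rtrancl)
qed (auto simp: vwalk_def)

lemma low_arcs_imp_vpath:
  assumes "pair_graph G" and "(x, y) \<in> (low_arcs G f c)\<^sup>*" and "x \<in> pverts G" and "f x \<le> c"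
  shows "\<exists>p. vpath p (with_proj G) \<and> hd p = x \<and> last p = y \<and> (\<forall>w \<in> set p. f w \<le> c)"
proof -
  interpret pair_graph G by fact
  have "\<exists>p. vwalk p (with_proj G) \<and> hd p = x \<and> last p = y \<and> (\<forall>w \<in> set p. f w \<le> c)"
    using assms(2,3,4)
  proof (induction rule: converse_rtrancl_induct)
    case base
    then show ?case by (intro exI[of _ "[y]"]) auto
  next
    case (step x z)
    then have "(x, z) \<in> parcs G" and "f z \<le> c" and "z \<in> pverts G"
      by (auto simp: low_arcs_def dest: in_arcsD2)
    with step obtain p where "vwalk p (with_proj G)" "hd p = z" "last p = y" "\<forall>w \<in> set p. f w \<le> c"
      by auto
    with step \<open>(x, z) \<in> parcs G\<close> show ?case
      by (intro exI[of _ "x # p"]) (auto intro!: vwalk_consI simp: vwalk_def)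
  qed
  then obtain p where p: "vwalk p (with_proj G)" "hd p = x" "last p = y" "\<forall>w \<in> set p. f w \<le> c"
    by blast
  show ?thesis
    using vwalk_to_vpath_vpath[OF p(1)] vwalk_to_vpath_hd[of p] vwalk_to_vpath_last[of p]
      vwalk_to_vpath_subset[of _ p] p by metis
qed

text \<open>
  A path that violates the ranking condition is one between equally labeled ends that stays below
  their label. Reachability expresses the existence of such a path without the path itself, which
  spares any surgery on paths when the graph changes.
\<close>

lemma is_ranking_iff_low_arcs:
  assumes "pair_graph G"
  shows "is_ranking k G f \<longleftrightarrow>
    f ` pverts G \<subseteq> {1..k} \<and>
    (\<forall>x \<in> pverts G. \<forall>y \<in> pverts G. x \<noteq> y \<and> f x = f y \<longrightarrow> (x, y) \<notin> (low_arcs G f (f x))\<^sup>*)"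
    (is "_ \<longleftrightarrow> _ \<and> ?sep")
proof (intro iffI conjI)
  assume r: "is_ranking k G f"
  then show "f ` pverts G \<subseteq> {1..k}" by (simp add: is_ranking_def)
  show ?sep
  proof (intro ballI impI notI)
    fix x y
    assume "x \<in> pverts G" "x \<noteq> y \<and> f x = f y" "(x, y) \<in> (low_arcs G f (f x))\<^sup>*"
    with low_arcs_imp_vpath[OF assms, of x y f "f x"] obtain p where
      "vpath p (with_proj G)" "hd p = x" "last p = y" "\<forall>w \<in> set p. f w \<le> f x" by blast
    with r \<open>x \<noteq> y \<and> f x = f y\<close> obtain w where "w \<in> set p" "f w > f x"
      unfolding is_ranking_def by blast
    with \<open>\<forall>w \<in> set p. f w \<le> f x\<close> show False by fastforce
  qed
next
  assume r: "f ` pverts G \<subseteq> {1..k} \<and> ?sep"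
  show "is_ranking k G f"
    unfolding is_ranking_def
  proof (intro conjI allI impI)
    fix p
    assume p: "vpath p (with_proj G) \<and> hd p \<noteq> last p \<and> f (hd p) = f (last p)"
    then have "vwalk p (with_proj G)" and "hd p \<in> pverts G" and "last p \<in> pverts G"
      by (auto simp: vpath_def vwalk_def)
    with p r have "(hd p, last p) \<notin> (low_arcs G f (f (hd p)))\<^sup>*" by blast
    with vwalk_imp_low_arcs[OF \<open>vwalk p (with_proj G)\<close>, of f "f (hd p)"]
    show "\<exists>w \<in> set p. f w > f (hd p)" by force
  qed (use r in blast)
qed

text \<open>
  The image of an arc need not be an arc: it may be a detour in \<open>G\<close>, provided that no label on the
  detour exceeds both labels at its ends. A violating connection in \<open>H\<close> then maps to a violating
  connection in \<open>G\<close>, and injectivity keeps its ends distinct. Deletions use the identity; contractions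
  need the detours.
\<close>

lemma is_ranking_pullback:
  assumes G: "pair_graph G" and H: "pair_graph H" and f: "is_ranking k G f"
    and s: "inj_on s (pverts H)" "s ` pverts H \<subseteq> pverts G"
    and arc: "\<And>a b. (a, b) \<in> parcs H \<Longrightarrow>
      (s a, s b) \<in> (low_arcs G f (max (f (s a)) (f (s b))))\<^sup>*"
  shows "is_ranking k H (f \<circ> s)"
proof -
  have lift: "(s x, s y) \<in> (low_arcs G f c)\<^sup>*" if "(x, y) \<in> (low_arcs H (f \<circ> s) c)\<^sup>*" for x y c
    using that
  proof (induction rule: rtrancl_induct)
    case (step y z)
    then have "(y, z) \<in> parcs H" "max (f (s y)) (f (s z)) \<le> c"
      by (auto simp: low_arcs_def)
    with arc low_arcs_mono have "(s y, s z) \<in> (low_arcs G f c)\<^sup>*" by blast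
    with step show ?case by simp
  qed simp
  have labels: "(f \<circ> s) ` pverts H \<subseteq> {1..k}"
    using f s by (auto simp: is_ranking_def)
  have "(x, y) \<notin> (low_arcs H (f \<circ> s) (f (s x)))\<^sup>*"
    if "x \<in> pverts H" "y \<in> pverts H" "x \<noteq> y" "f (s x) = f (s y)" for x y
  proof
    assume "(x, y) \<in> (low_arcs H (f \<circ> s) (f (s x)))\<^sup>*"
    then have "(s x, s y) \<in> (low_arcs G f (f (s x)))\<^sup>*" by (rule lift)
    moreover have "s x \<noteq> s y" "s x \<in> pverts G" "s y \<in> pverts G"
      using that s by (auto dest: inj_onD)
    ultimately show False
      using f that(4) by (simp add: is_ranking_iff_low_arcs[OF G])
  qed
  with labels show ?thesis
    by (simp add: is_ranking_iff_low_arcs[OF H])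
qed

lemma is_ranking_subgraph:
  assumes "pair_graph G" "pair_graph H" "is_ranking k G f"
    and "pverts H \<subseteq> pverts G" "parcs H \<subseteq> parcs G"
  shows "is_ranking k H f"
proof -
  have "is_ranking k H (f \<circ> id)"
  proof (rule is_ranking_pullback[OF assms(1-3)])
    fix a b assume "(a, b) \<in> parcs H"
    then have "(a, b) \<in> low_arcs G f (max (f a) (f b))"
      using assms(5) by (auto simp: low_arcs_def)
    then show "(id a, id b) \<in> (low_arcs G f (max (f (id a)) (f (id b))))\<^sup>*" by auto
  qed (use assms(4) in auto)
  then show ?thesis by simp
qed

section \<open>Tree-depth\<close>

lemma tree_depth_le: "is_ranking k G f \<Longrightarrow> tree_depth G \<le> k"
  unfolding tree_depth_def by (rule Least_le) blast

lemma ex_optimal_ranking: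
  assumes "pair_graph G"
  shows "\<exists>f. is_ranking (tree_depth G) G f"
proof -
  interpret pair_graph G by fact
  obtain h where h: "bij_betw h (pverts G) {1..card (pverts G)}"
    using pair_finite_verts finite_same_card_bij[of "pverts G" "{1..card (pverts G)}"] by auto
  have "is_ranking (card (pverts G)) G h"
    unfolding is_ranking_iff_low_arcs[OF assms]
  proof (intro conjI ballI impI)
    show "h ` pverts G \<subseteq> {1..card (pverts G)}"
      using bij_betw_imp_surj_on[OF h] by simp
    fix x y assume "x \<in> pverts G" "y \<in> pverts G" "x \<noteq> y \<and> h x = h y"
    then have False using inj_onD[OF bij_betw_imp_inj_on[OF h], of x y] by simp
    then show "(x, y) \<notin> (low_arcs G h (h x))\<^sup>*" ..
  qed
  then have "\<exists>f. is_ranking (card (pverts G)) G f" by blast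
  then show ?thesis
    unfolding tree_depth_def by (rule LeastI[where P = "\<lambda>k. \<exists>f. is_ranking k G f"])
qed

text \<open>Shifting all labels down by 1 keeps their order, which is all that the ranking condition uses.\<close>

lemma tree_depth_less:
  assumes "is_ranking k G f" and "1 \<notin> f ` pverts G" and "0 < k"
  shows "tree_depth G < k"
proof -
  have range: "f x \<in> {2..k}" if "x \<in> pverts G" for x
  proof -
    have "f ` pverts G \<subseteq> {1..k}" using assms(1) by (simp add: is_ranking_def)
    then have "f x \<in> {1..k}" using that by blast
    moreover have "f x \<noteq> 1" using assms(2) that by (metis imageI)
    ultimately show ?thesis by auto
  qed
  have "is_ranking (k - 1) G (\<lambda>x. f x - 1)"
    unfolding is_ranking_def
  proof (intro conjI allI impI)
    show "(\<lambda>x. f x - 1) ` pverts G \<subseteq> {1..k - 1}" using range by fastforce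
    fix p
    assume p: "vpath p (with_proj G) \<and> hd p \<noteq> last p \<and> f (hd p) - 1 = f (last p) - 1"
    then have "set p \<subseteq> pverts G" "p \<noteq> []" by (auto simp: vpath_def vwalk_def)
    then have "hd p \<in> pverts G" "last p \<in> pverts G" by auto
    then have "f (hd p) \<ge> 2" "f (last p) \<ge> 2"
      using range by auto
    with p have "f (hd p) = f (last p)" by auto
    with p assms(1) obtain w where "w \<in> set p" "f w > f (hd p)"
      by (auto simp: is_ranking_def)
    with \<open>f (hd p) \<ge> 2\<close> show "\<exists>w \<in> set p. f w - 1 > f (hd p) - 1"
      by (intro bexI[of _ w]) auto
  qed
  then have "tree_depth G \<le> k - 1" by (rule tree_depth_le)
  with \<open>0 < k\<close> show ?thesis by simp
qed

section \<open>Minor steps\<close>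

lemma pair_graphI:
  assumes "finite (pverts G)" and "parcs G \<subseteq> pverts G \<times> pverts G" and "sym (parcs G)"
    and "\<And>x. (x, x) \<notin> parcs G"
  shows "pair_graph G"
proof
  show "finite (parcs G)"
    using assms(1,2) by (meson finite_SigmaI finite_subset)
  show "symmetric (with_proj G)"
    using assms(3) by (simp add: symmetric_def)
  show "fst e \<noteq> snd e" if "e \<in> parcs G" for e
    using assms(4) that by (cases e) auto
qed (use assms(1,2) in auto)

lemma pair_graphD:
  assumes "pair_graph G"
  shows "finite (pverts G)" and "finite (parcs G)" and "parcs G \<subseteq> pverts G \<times> pverts G"
    and "sym (parcs G)" and "(x, x) \<notin> parcs G"
proof -
  interpret pair_graph G by fact
  show "finite (pverts G)" "finite (parcs G)"
    by (rule pair_finite_verts pair_finite_arcs)+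
  show "parcs G \<subseteq> pverts G \<times> pverts G" "(x, x) \<notin> parcs G"
    by (auto dest: in_arcsD1 in_arcsD2 no_loops')
  show "sym (parcs G)"
    by (rule symI) (rule arcs_symmetric)
qed

lemma pair_graph_delete_vertex: "pair_graph G \<Longrightarrow> pair_graph (delete_vertex v G)"
  using pair_graphD[of G]
  by (intro pair_graphI) (auto simp: delete_vertex_def sym_def)

lemma pair_graph_delete_edge: "pair_graph G \<Longrightarrow> pair_graph (delete_edge u v G)"
  using pair_graphD[of G]
  by (intro pair_graphI) (auto simp: delete_edge_def sym_def)

lemma pair_graph_contract_edge:
  assumes "pair_graph G" and "(u, v) \<in> parcs G"
  shows "pair_graph (contract_edge u v G)"
proof -
  note G = pair_graphD[OF assms(1)]
  have "u \<in> pverts G" "u \<noteq> v" using G(3,5) assms(2) by auto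
  show ?thesis
  proof (rule pair_graphI)
    show "finite (pverts (contract_edge u v G))"
      using G(1) by (simp add: contract_edge_def Let_def)
    show "parcs (contract_edge u v G)
        \<subseteq> pverts (contract_edge u v G) \<times> pverts (contract_edge u v G)"
      using G(3) \<open>u \<in> pverts G\<close> \<open>u \<noteq> v\<close> by (auto simp: contract_edge_def Let_def)
    show "sym (parcs (contract_edge u v G))"
      using symD[OF G(4)] by (intro symI) (simp add: contract_edge_def Let_def, metis)
  qed (simp add: contract_edge_def Let_def)
qed

lemma pair_graph_minor_step:
  assumes "minor_step G H" and "pair_graph G"
  shows "pair_graph H"
  using assms
  by cases (simp_all add: pair_graph_delete_vertex pair_graph_delete_edge pair_graph_contract_edge)

lemma is_ranking_delete_vertex:
  assumes "pair_graph G" and "is_ranking k G f"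
  shows "is_ranking k (delete_vertex v G) f"
  by (rule is_ranking_subgraph[OF assms(1) pair_graph_delete_vertex[OF assms(1)] assms(2)])
     (auto simp: delete_vertex_def)

lemma is_ranking_delete_edge:
  assumes "pair_graph G" and "is_ranking k G f"
  shows "is_ranking k (delete_edge u v G) f"
  by (rule is_ranking_subgraph[OF assms(1) pair_graph_delete_edge[OF assms(1)] assms(2)])
     (auto simp: delete_edge_def)

text \<open>
  The merged vertex is represented by the end of \<open>uv\<close> with the larger label: whenever that end lies
  on a path through labels at most \<open>c\<close>, the other end may be visited as well.
\<close>

lemma is_ranking_contract_edge:
  assumes G: "pair_graph G" and uv: "(u, v) \<in> parcs G" and f: "is_ranking k G f"
  shows "is_ranking k (contract_edge u v G) (f(u := max (f u) (f v)))"
proof -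
  note G' = pair_graphD[OF G]
  define s where "s = id(u := if f u < f v then v else u)"
  define m where "m x = (if x = v then u else x)" for x
  have "is_ranking k (contract_edge u v G) (f \<circ> s)"
  proof (rule is_ranking_pullback[OF G pair_graph_contract_edge[OF G uv] f])
    show "inj_on s (pverts (contract_edge u v G))"
      by (auto simp: inj_on_def s_def contract_edge_def Let_def)
    show "s ` pverts (contract_edge u v G) \<subseteq> pverts G"
      using uv G'(3) by (auto simp: s_def contract_edge_def Let_def)
    have vu: "(v, u) \<in> parcs G" using symD[OF G'(4) uv] .
    \<comment> \<open>Every vertex of the graph is joined to its representative in both directions, below the
      representative's label.\<close>
    have rep: "f x \<le> f (s (m x)) \<and>
        (s (m x), x) \<in> (low_arcs G f (f (s (m x))))\<^sup>* \<and>
        (x, s (m x)) \<in> (low_arcs G f (f (s (m x))))\<^sup>*" for x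
      using uv vu by (auto simp: s_def m_def low_arcs_def)
    fix a b assume "(a, b) \<in> parcs (contract_edge u v G)"
    then obtain x y where xy: "(x, y) \<in> parcs G" "a = m x" "b = m y"
      by (auto simp: contract_edge_def Let_def m_def)
    let ?c = "max (f (s a)) (f (s b))"
    have "(s a, x) \<in> (low_arcs G f ?c)\<^sup>*" "(y, s b) \<in> (low_arcs G f ?c)\<^sup>*"
      using rep[of x] rep[of y] low_arcs_mono[of _ ?c G f] xy(2,3)
      by (meson max.cobounded1 max.cobounded2 subsetD)+
    moreover have "(x, y) \<in> low_arcs G f ?c"
      using rep[of x] rep[of y] xy by (simp add: low_arcs_def le_max_iff_disj)
    ultimately show "(s a, s b) \<in> (low_arcs G f ?c)\<^sup>*"
      by (meson rtrancl.rtrancl_into_rtrancl rtrancl_trans)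
  qed
  moreover have "f \<circ> s = f(u := max (f u) (f v))"
    by (auto simp: s_def fun_eq_iff)
  ultimately show ?thesis by simp
qed

lemma tree_depth_minor_step_le:
  assumes "minor_step G H" and "pair_graph G"
  shows "tree_depth H \<le> tree_depth G"
proof -
  obtain f where f: "is_ranking (tree_depth G) G f"
    using ex_optimal_ranking[OF assms(2)] by blast
  from assms(1) show ?thesis
  proof cases
    case (1 v)
    then show ?thesis
      using tree_depth_le[OF is_ranking_delete_vertex[OF assms(2) f]] by simp
  next
    case (2 u v)
    then show ?thesis
      using tree_depth_le[OF is_ranking_delete_edge[OF assms(2) f]] by simp
  next
    case (3 u v)
    then show ?thesis
      using tree_depth_le[OF is_ranking_contract_edge[OF assms(2) _ f]] by simp
  qed
qed

lemma tree_depth_minor_steps_le: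
  assumes "minor_step\<^sup>*\<^sup>* G H" and "pair_graph G"
  shows "tree_depth H \<le> tree_depth G"
  using assms
proof (induction rule: converse_rtranclp_induct)
  case (step G G')
  then have "tree_depth H \<le> tree_depth G'" by (blast intro: pair_graph_minor_step)
  also have "\<dots> \<le> tree_depth G" using step by (blast intro: tree_depth_minor_step_le)
  finally show ?case .
qed simp

text \<open>Since no minor step raises the tree-depth, criticality has to be checked for the first step only.\<close>

lemma criticalI:
  assumes "pair_graph G" and "tree_depth G = k" and "\<And>H. minor_step G H \<Longrightarrow> tree_depth H < k"
  shows "critical k G"
  unfolding critical_def proper_minor_def
proof (intro conjI allI impI)
  fix H assume "minor_step\<^sup>+\<^sup>+ G H"
  then obtain G' where G': "minor_step G G'" "minor_step\<^sup>*\<^sup>* G' H"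
    by (meson tranclpD)
  then have "tree_depth H \<le> tree_depth G'"
    using assms(1) by (blast intro: tree_depth_minor_steps_le pair_graph_minor_step)
  also have "\<dots> < k" using G' assms(3) by blast
  finally show "tree_depth H < k" .
qed (fact assms(2))

section \<open>1-unique graphs\<close>

lemma one_uniqueE:
  assumes "one_unique G" and "v \<in> pverts G"
  obtains f where "is_ranking (tree_depth G) G f" and "f v = 1"
    and "\<And>u. u \<in> pverts G \<Longrightarrow> f u = 1 \<Longrightarrow> u = v" and "0 < tree_depth G"
proof -
  obtain f where f: "is_ranking (tree_depth G) G f" "{u \<in> pverts G. f u = 1} = {v}"
    using assms by (auto simp: one_unique_def optimal_ranking_def)
  have "f v = 1" using f(2) by blast
  moreover have "f v \<le> tree_depth G" using f(1) assms(2) by (auto simp: is_ranking_def)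
  ultimately show thesis using f by (intro that[of f]) auto
qed

lemma one_unique_delete_vertex:
  assumes "pair_graph G" and "one_unique G" and "v \<in> pverts G"
  shows "tree_depth (delete_vertex v G) < tree_depth G"
proof -
  obtain f where f: "is_ranking (tree_depth G) G f" "\<And>u. u \<in> pverts G \<Longrightarrow> f u = 1 \<Longrightarrow> u = v"
    "0 < tree_depth G"
    using one_uniqueE[OF assms(2,3)] by metis
  have "1 \<notin> f ` pverts (delete_vertex v G)"
    using f(2) by (fastforce simp: delete_vertex_def)
  with is_ranking_delete_vertex[OF assms(1) f(1)] f(3) show ?thesis
    by (blast intro: tree_depth_less)
qed

lemma one_unique_contract_edge:
  assumes "pair_graph G" and "one_unique G" and "(u, v) \<in> parcs G"
  shows "tree_depth (contract_edge u v G) < tree_depth G"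
proof -
  have "u \<in> pverts G" "v \<in> pverts G"
    using pair_graphD(3)[OF assms(1)] assms(3) by auto
  then obtain f where f: "is_ranking (tree_depth G) G f" "f v = 1"
    "\<And>u. u \<in> pverts G \<Longrightarrow> f u = 1 \<Longrightarrow> u = v" "0 < tree_depth G"
    using one_uniqueE[OF assms(2)] by metis
  \<comment> \<open>The label 1 of \<open>v\<close> is the smallest, so the merged vertex keeps the label of \<open>u\<close>.\<close>
  have "f v \<le> f u"
    using f(1,2) \<open>u \<in> pverts G\<close> by (auto simp: is_ranking_def)
  then have "f(u := max (f u) (f v)) = f" by auto
  then have "is_ranking (tree_depth G) (contract_edge u v G) f"
    using is_ranking_contract_edge[OF assms(1,3) f(1)] by simp
  moreover have "1 \<notin> f ` pverts (contract_edge u v G)"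
    using f(3) by (fastforce simp: contract_edge_def Let_def)
  ultimately show ?thesis
    using f(4) by (blast intro: tree_depth_less)
qed

lemma one_unique_spanning_subgraph:
  assumes "pair_graph G" "pair_graph H" "pverts H = pverts G" "parcs H \<subseteq> parcs G"
    and "tree_depth H = tree_depth G" "one_unique G"
  shows "one_unique H"
  unfolding one_unique_def optimal_ranking_def
proof
  fix v assume "v \<in> pverts H"
  with assms(3,6) obtain f
    where f: "is_ranking (tree_depth G) G f" "{u \<in> pverts G. f u = 1} = {v}"
    unfolding one_unique_def optimal_ranking_def by blast
  have "is_ranking (tree_depth H) H f"
    using is_ranking_subgraph[OF assms(1,2) f(1)] assms(3-5) by simp
  with f(2) assms(3) show "\<exists>f. is_ranking (tree_depth H) H f \<and> {u \<in> pverts H. f u = 1} = {v}"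
    by auto
qed

lemma spanning_iff:
  assumes "pair_graph G" and "pair_graph H"
  shows "spanning (with_proj H) (with_proj G) \<longleftrightarrow> pverts H = pverts G \<and> parcs H \<subseteq> parcs G"
proof -
  interpret G: pair_graph G by fact
  interpret H: pair_graph H by fact
  show ?thesis
    using G.wf_digraph_axioms H.wf_digraph_axioms
    by (auto simp: spanning_def subgraph_def compatible_def)
qed

theorem theorem3p5:
  fixes G :: "'a pair_pre_digraph"
  assumes "pair_graph G"
    and "one_unique G"
    and "tree_depth G = k"
  shows "\<exists>H :: 'a pair_pre_digraph. pair_graph H \<and> spanning H G \<and> critical k H"
proof -
  define P where "P H \<longleftrightarrow>
    pair_graph H \<and> pverts H = pverts G \<and> parcs H \<subseteq> parcs G \<and> tree_depth H = k" for H
  have "P G" using assms by (simp add: P_def)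
  then obtain H where "P H" and min: "\<And>H'. P H' \<Longrightarrow> card (parcs H) \<le> card (parcs H')"
    using ex_has_least_nat[of P G "\<lambda>H. card (parcs H)"] by blast
  then have H: "pair_graph H" "pverts H = pverts G" "parcs H \<subseteq> parcs G" "tree_depth H = k"
    by (auto simp: P_def)
  have unique: "one_unique H"
    using one_unique_spanning_subgraph[OF assms(1) H(1-3)] H(4) assms(2,3) by simp
  have edge: "tree_depth (delete_edge u v H) < k" if uv: "(u, v) \<in> parcs H" for u v
  proof -
    have "card (parcs (delete_edge u v H)) < card (parcs H)"
      using uv pair_graphD(2)[OF H(1)] by (intro psubset_card_mono) (auto simp: delete_edge_def)
    then have "\<not> P (delete_edge u v H)"
      using min by (meson not_le)
    then have "tree_depth (delete_edge u v H) \<noteq> k"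
      using H pair_graph_delete_edge[OF H(1)] by (auto simp: P_def delete_edge_def)
    moreover have "tree_depth (delete_edge u v H) \<le> k"
      using tree_depth_minor_step_le[OF minor_step.intros(2)[OF uv] H(1)] H(4) by simp
    ultimately show ?thesis by simp
  qed
  have "tree_depth H' < k" if "minor_step H H'" for H'
    using that
  proof cases
    case (1 v)
    then show ?thesis using one_unique_delete_vertex[OF H(1) unique] H(4) by simp
  next
    case (2 u v)
    then show ?thesis using edge by simp
  next
    case (3 u v)
    then show ?thesis using one_unique_contract_edge[OF H(1) unique] H(4) by simp
  qed
  then have "critical k H"
    by (rule criticalI[OF H(1,4)])
  moreover have "spanning H G"
    using H by (simp add: spanning_iff[OF assms(1) H(1)])
  ultimately show ?thesis using H(1) by blast
qed

end
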